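(* Let $s,t\in[0,T]$ be such that there is no $\alpha\in\mathbb{R}/(2\pi\mathbb{Z})$ with $\nu_s(\mathrm{Q}(\alpha)\boldsymbol{k})=\nu_t(\boldsymbol{k})$ for all $\boldsymbol{k}\in\mathcal{B}^2_{k_0}$, and there is no $\alpha\in\mathbb{R}/(2\pi\mathbb{Z})$ with $\nu_s(\mathrm{S}\,\mathrm{Q}(\alpha)\boldsymbol{k})=\nu_t(\boldsymbol{k})$ for all $\boldsymbol{k}\in\mathcal{B}^2_{k_0}$. Furthermore, assume that there exist unique angles $\varphi,\psi\in\mathbb{R}/(2\pi\mathbb{Z})$ and $\theta\in[0,\pi]$ such that both $$\nu_s(\boldsymbol{\gamma}^{\varphi,\theta}(\beta))=\nu_t(\boldsymbol{\gamma}^{\pi-\psi,\theta}(-\beta))\quad\text{for all }\beta\in[-\tfrac{\pi}{2},\tfrac{\pi}{2}]$$ and $$\nu_s(\boldsymbol{\gamma}^{*,\varphi,\theta}(\beta))=\nu_t(\boldsymbol{\gamma}^{*,\pi-\psi,\theta}(\beta))\quad\text{for all }\beta\in[-\tfrac{\pi}{2},\tfrac{\pi}{2}].$$ Then $$R_s^\top R_t=Q^{(3)}(\varphi)\,Q^{(2)}(\theta)\,Q^{(3)}(\psi).$$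
   Context: Fix $k_0>0$, $T>0$. $f\colon\mathbb{R}^3\to[0,\infty)$ is a piecewise continuous function supported in an open ball around $\boldsymbol 0$; its Fourier transform is $\mathcal{F}[f](\boldsymbol y)=(2\pi)^{-3/2}\int_{\mathbb{R}^3}f(\boldsymbol x)\,e^{-i\langle\boldsymbol x,\boldsymbol y\rangle}\,d\boldsymbol x$. For each $t\in[0,T]$ let $R_t\in\mathrm{SO}(3)$, with $R_0=I$. Let $\mathcal{B}^2_{k_0}=\{\boldsymbol k\in\mathbb{R}^2:\|\boldsymbol k\|<k_0\}$, and define $\kappa(\boldsymbol k)=\sqrt{k_0^2-\|\boldsymbol k\|^2}$, $\boldsymbol h(\boldsymbol k)=(k_1,k_2,\kappa(\boldsymbol k)-k_0)^\top$ and the scaled squared energy $$\nu_t(\boldsymbol k)=\left|\mathcal{F}[f](R_t\boldsymbol h(\boldsymbol k))\right|^2$$ for $\boldsymbol k\in\mathcal{B}^2_{k_0}$, extended by the same formulas to the closed disk $\|\boldsymbol k\|\le k_0$. Matrices: $\mathrm{S}=\begin{pmatrix}1&0\\0&-1\end{pmatrix}$, $\mathrm{Q}(\alpha)=\begin{pmatrix}\cos\alpha&-\sin\alpha\\\sin\alpha&\cos\alpha\end{pmatrix}$, $Q^{(2)}(\alpha)=\begin{pmatrix}\cos\alpha&0&\sin\alpha\\0&1&0\\-\sin\alpha&0&\cos\alpha\end{pmatrix}$, $Q^{(3)}(\alpha)=\begin{pmatrix}\cos\alpha&-\sin\alpha&0\\\sin\alpha&\cos\alpha&0\\0&0&1\end{pmatrix}$.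 Curves: for $\varphi\in\mathbb{R}/(2\pi\mathbb{Z})$, $\theta\in[0,\pi]$, $\beta\in\mathbb{R}$, $$\boldsymbol\gamma^{\varphi,\theta}(\beta)=\tfrac{k_0}{2}\sin(\theta)(\cos(\beta)-1)\begin{pmatrix}\cos\varphi\\\sin\varphi\end{pmatrix}+k_0\cos(\tfrac\theta2)\sin(\beta)\begin{pmatrix}-\sin\varphi\\\cos\varphi\end{pmatrix},$$ $$\boldsymbol\gamma^{*,\varphi,\theta}(\beta)=-\tfrac{k_0}{2}\sin(\theta)(\cos(\beta)-1)\begin{pmatrix}\cos\varphi\\\sin\varphi\end{pmatrix}-k_0\sin(\tfrac\theta2)\sin(\beta)\begin{pmatrix}-\sin\varphi\\\cos\varphi\end{pmatrix}.$$ *)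

theory Defs
  imports "HOL-Analysis.Analysis" "HOL-Library.Real_Mod"
begin

text \<open>
  Piecewise continuity in several variables: the space is tiled by finitely many open pieces with
  null boundaries, and on each piece \<open>f\<close> agrees with a function that is continuous up to
  the boundary. The values of \<open>f\<close> on the boundaries are arbitrary, so \<open>f\<close> need not
  be Borel measurable, but it is Lebesgue measurable.
\<close>

definition piecewise_continuous :: "(real^3 \<Rightarrow> real) \<Rightarrow> bool" where
  "piecewise_continuous f \<longleftrightarrow>
     (\<exists>\<U>. finite \<U> \<and> disjoint \<U> \<and> (\<Union>U\<in>\<U>. closure U) = UNIV \<and>
          (\<forall>U\<in>\<U>. open U \<and> negligible (frontier U) \<and>
                (\<exists>g. continuous_on (closure U) g \<and> (\<forall>x\<in>U. f x = g x))))"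

lemma piecewise_continuous_integrable:
  fixes f :: "real^3 \<Rightarrow> real"
  assumes "piecewise_continuous f" and r: "closure {x. f x \<noteq> 0} \<subseteq> ball 0 r"
  shows "integrable lebesgue f"
proof -
  obtain \<U> where fin: "finite \<U>" and dis: "disjoint \<U>"
    and cov: "(\<Union>U\<in>\<U>. closure U) = UNIV"
    and op: "\<And>U. U \<in> \<U> \<Longrightarrow> open U" and negl: "\<And>U. U \<in> \<U> \<Longrightarrow> negligible (frontier U)"
    and ex: "\<And>U. U \<in> \<U> \<Longrightarrow> \<exists>g. continuous_on (closure U) g \<and> (\<forall>x\<in>U. f x = g x)"
    using assms(1) unfolding piecewise_continuous_def by blast
  obtain g where g: "\<And>U. U \<in> \<U> \<Longrightarrow> continuous_on (closure U) (g U)"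
    and fg: "\<And>U x. U \<in> \<U> \<Longrightarrow> x \<in> U \<Longrightarrow> f x = g U x"
    using ex by metis
  define h where "h x = (\<Sum>U\<in>\<U>. indicat_real (U \<inter> ball 0 r) x *\<^sub>R g U x)" for x
  have int: "set_integrable lebesgue (U \<inter> ball 0 r) (g U)" if "U \<in> \<U>" for U
  proof -
    have "compact (closure U \<inter> cball 0 r)"
      by (simp add: closed_Int_compact)
    then have "set_integrable lborel (closure U \<inter> cball 0 r) (g U)"
      unfolding set_integrable_def
      by (intro borel_integrable_compact continuous_on_subset[OF g[OF that]]) auto
    then have "set_integrable lebesgue (closure U \<inter> cball 0 r) (g U)"
      unfolding set_integrable_def by (simp add: integrable_completion borel_measurable_integrable)
    moreover have "U \<inter> ball 0 r \<in> sets lebesgue"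
      using op[OF that] by (intro sets_completionI_sets) auto
    ultimately show ?thesis
      using closure_subset[of U] ball_subset_cball[of 0 r]
      by (meson Int_mono set_integrable_subset)
  qed
  then have h: "integrable lebesgue h"
    unfolding h_def set_integrable_def by (intro Bochner_Integration.integrable_sum) auto
  have N: "negligible (\<Union>(frontier ` \<U>))"
    using fin negl by (intro negligible_Union) auto
  have fh: "f x = h x" if "x \<notin> \<Union>(frontier ` \<U>)" for x
  proof -
    obtain U where U: "U \<in> \<U>" "x \<in> closure U"
      using cov by blast
    with that op have xU: "x \<in> U"
      by (auto simp: frontier_def interior_open)
    have "x \<notin> V" if "V \<in> \<U>" "V \<noteq> U" for V
      using dis U that xU by (meson disjnt_iff pairwiseD)
    then have "h x = (\<Sum>V\<in>{U}. indicat_real (V \<inter> ball 0 r) x *\<^sub>R g V x)"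
      unfolding h_def using fin U by (intro sum.mono_neutral_right) auto
    then have "h x = indicat_real (U \<inter> ball 0 r) x *\<^sub>R g U x"
      by (simp only: sum.insert finite.emptyI empty_iff not_False_eq_True sum.empty add_0_right)
    moreover have "x \<in> ball 0 r" if "f x \<noteq> 0"
      using r closure_subset[of "{x. f x \<noteq> 0}"] that by auto
    ultimately show ?thesis
      using fg[OF U(1) xU] xU by (cases "x \<in> ball 0 r") (auto simp: indicator_def)
  qed
  have "h absolutely_integrable_on UNIV"
    using h by (simp add: set_integrable_def)
  then have "f absolutely_integrable_on UNIV"
    using N by (rule absolutely_integrable_spike) (use fh in auto)
  then show ?thesis
    by (simp add: set_integrable_def)
qed

definition fourier :: "(real^3 \<Rightarrow> real) \<Rightarrow> real^3 \<Rightarrow> complex" where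
  "fourier f y = (2 * pi) powr (- (3/2)) *\<^sub>R
     (LINT x|lebesgue. complex_of_real (f x) * exp (- \<i> * complex_of_real (x \<bullet> y)))"

definition kappa :: "real \<Rightarrow> real^2 \<Rightarrow> real" where
  "kappa k0 k = sqrt (k0^2 - (norm k)^2)"

definition hvec :: "real \<Rightarrow> real^2 \<Rightarrow> real^3" where
  "hvec k0 k = vector [k$1, k$2, kappa k0 k - k0]"

text \<open>
  Only meaningful on the closed disk \<open>norm k \<le> k0\<close>: outside it the square root of a
  negative number in \<open>kappa\<close> is an artefact of the total function \<open>sqrt\<close>.
\<close>

definition nu :: "real \<Rightarrow> (real^3 \<Rightarrow> real) \<Rightarrow> (real \<Rightarrow> real^3^3) \<Rightarrow> real \<Rightarrow> real^2 \<Rightarrow> real" where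
  "nu k0 f R t k = (cmod (fourier f (R t *v hvec k0 k)))^2"

definition S :: "real^2^2" where
  "S = vector [vector [1, 0], vector [0, -1]]"

definition Q :: "real \<Rightarrow> real^2^2" where
  "Q \<alpha> = vector [vector [cos \<alpha>, - sin \<alpha>],
                  vector [sin \<alpha>,   cos \<alpha>]]"

definition Q2 :: "real \<Rightarrow> real^3^3" where
  "Q2 \<alpha> = vector [vector [cos \<alpha>,   0, sin \<alpha>],
                   vector [0,       1, 0],
                   vector [- sin \<alpha>, 0, cos \<alpha>]]"

definition Q3 :: "real \<Rightarrow> real^3^3" where
  "Q3 \<alpha> = vector [vector [cos \<alpha>, - sin \<alpha>, 0],
                   vector [sin \<alpha>,   cos \<alpha>, 0],
                   vector [0,       0,       1]]"

definition gamma :: "real \<Rightarrow> real \<Rightarrow> real \<Rightarrow> real \<Rightarrow> real^2" where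
  "gamma k0 \<phi> \<theta> \<beta> =
     (k0/2 * sin \<theta> * (cos \<beta> - 1)) *\<^sub>R vector [cos \<phi>, sin \<phi>] +
     (k0 * cos (\<theta>/2) * sin \<beta>) *\<^sub>R vector [- sin \<phi>, cos \<phi>]"

definition gamma_dual :: "real \<Rightarrow> real \<Rightarrow> real \<Rightarrow> real \<Rightarrow> real^2" where
  "gamma_dual k0 \<phi> \<theta> \<beta> =
     (- (k0/2) * sin \<theta> * (cos \<beta> - 1)) *\<^sub>R vector [cos \<phi>, sin \<phi>] -
     (k0 * sin (\<theta>/2) * sin \<beta>) *\<^sub>R vector [- sin \<phi>, cos \<phi>]"

text \<open>
  Angles in \<open>\<real>/2\<pi>\<int>\<close> are given by real representatives; everything above depends
  on \<open>\<phi>\<close>, \<open>\<psi>\<close> and on the arguments of \<open>Q\<close>, \<open>Q2\<close>,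
  \<open>Q3\<close> only modulo \<open>2\<pi>\<close>.
\<close>

definition matching_angles ::
  "real \<Rightarrow> (real^3 \<Rightarrow> real) \<Rightarrow> (real \<Rightarrow> real^3^3) \<Rightarrow> real \<Rightarrow> real \<Rightarrow> real \<Rightarrow> real \<Rightarrow> real \<Rightarrow> bool" where
  "matching_angles k0 f R s t \<phi> \<psi> \<theta> \<longleftrightarrow>
     (\<forall>\<beta>\<in>{-pi/2..pi/2}.
        nu k0 f R s (gamma k0 \<phi> \<theta> \<beta>) = nu k0 f R t (gamma k0 (pi - \<psi>) \<theta> (- \<beta>))) \<and>
     (\<forall>\<beta>\<in>{-pi/2..pi/2}.
        nu k0 f R s (gamma_dual k0 \<phi> \<theta> \<beta>) = nu k0 f R t (gamma_dual k0 (pi - \<psi>) \<theta> \<beta>))"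

end

theory Submission
  imports Defs
begin

text \<open>
  Write \<open>H\<close> for the hemisphere \<open>hvec k0 ` cball 0 k0\<close>: it is the half
  around the origin of the sphere with centre \<open>- k0 e\<^sub>3\<close> and radius
  \<open>k0\<close>. The data \<open>\<nu>\<^sub>s\<close> and \<open>\<nu>\<^sub>t\<close> are the
  values of \<open>\<bar>fourier f\<bar>\<^sup>2\<close> on the rotated copies
  \<open>R\<^sub>s H\<close> and \<open>R\<^sub>t H\<close>. Wherever these copies meet, the two data
  sets share a value. Since \<open>f\<close> is real, \<open>\<bar>fourier f\<bar>\<close> is even, so
  they also share a value wherever \<open>R\<^sub>s H\<close> meets \<open>- R\<^sub>t H\<close>. All
  these spheres pass through the origin, and in general position two of them intersect in a circle
  through the origin. If \<open>\<phi>, \<theta>, \<psi>\<close> are Euler angles of the relative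
  rotation \<open>R\<^sub>s\<^sup>T R\<^sub>t\<close>, then \<open>gamma\<close> and \<open>gamma_dual\<close>
  parametrise the projections of these two circles to the coordinates of
  \<open>\<nu>\<^sub>s\<close> and \<open>\<nu>\<^sub>t\<close>, in such a way that corresponding points
  carry the same parameter up to sign.

  Hence Euler angles of the relative rotation always satisfy the two matching conditions
  (\<open>euler_angles_match\<close>). Every rotation has Euler angles
  (\<open>rotation_matrix_euler_angles\<close>), so if only one triple of angles matches, it is a triple
  of Euler angles of \<open>R\<^sub>s\<^sup>T R\<^sub>t\<close>.
\<close>

section \<open>Products of elementary rotations\<close>

lemma Q3_Q3: "Q3 a ** Q3 b = Q3 (a + b)"
  by (simp add: Q3_def matrix_matrix_mult_def vec_eq_iff forall_3 sum_3 cos_add sin_add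
      algebra_simps)

lemma Q3_two_pi [simp]: "Q3 (2 * pi) = mat 1"
  by (simp add: Q3_def mat_def vec_eq_iff forall_3)

lemma Q3_rcong:
  assumes "[a = b] (rmod (2 * pi))"
  shows "Q3 a = Q3 b"
proof -
  obtain n where "b = a + of_int n * (2 * pi)"
    using assms unfolding rcong_altdef by blast
  then have "sin b = sin a \<and> cos b = cos a"
    unfolding sin_cos_eq_iff by (intro exI[of _ n]) simp
  then show ?thesis
    by (simp add: Q3_def)
qed

lemma Q3_minus: "transpose (Q3 a) = Q3 (- a)"
  by (simp add: Q3_def transpose_def vec_eq_iff forall_3)

lemma rotation_matrix_Q3: "rotation_matrix (Q3 a)"
proof -
  have "Q3 0 = mat 1"
    by (simp add: Q3_def mat_def vec_eq_iff forall_3)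
  then show ?thesis
    by (simp add: rotation_matrix_def orthogonal_matrix Q3_minus Q3_Q3)
      (simp add: Q3_def det_3 flip: power2_eq_square)
qed

lemma rotation_matrix_Q2: "rotation_matrix (Q2 a)"
  unfolding rotation_matrix_def orthogonal_matrix
  by (simp add: Q2_def det_3 transpose_def matrix_matrix_mult_def vec_eq_iff forall_3 sum_3 mat_def
      flip: power2_eq_square)

lemma rotation_matrix_mul:
  fixes A B :: "real^'n^'n"
  shows "rotation_matrix A \<Longrightarrow> rotation_matrix B \<Longrightarrow> rotation_matrix (A ** B)"
  by (simp add: rotation_matrix_def orthogonal_matrix_mul det_mul)

lemma rotation_matrix_transpose: "rotation_matrix A \<Longrightarrow> rotation_matrix (transpose A)"
  by (simp add: rotation_matrix_def)

section \<open>Euler angles\<close>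

text \<open>
  The third row of a rotation that fixes \<open>e\<^sub>3\<close> is \<open>e\<^sub>3\<close> as well, because
  its transpose is its inverse. What remains is a planar rotation.
\<close>

lemma rotation_matrix_fixing_axis:
  fixes A :: "real^3^3"
  assumes A: "rotation_matrix A" and ax: "A *v axis 3 1 = axis 3 1"
  obtains \<psi> where "A = Q3 \<psi>"
proof -
  have orth: "transpose A ** A = mat 1" and det: "det A = 1"
    using A by (simp_all add: rotation_matrix_def orthogonal_matrix)
  have "transpose A *v axis 3 1 = transpose A *v (A *v axis 3 1)"
    using ax by simp
  also have "\<dots> = axis 3 1"
    by (simp add: matrix_vector_mul_assoc orth)
  finally have row: "transpose A *v axis 3 1 = axis 3 1" .
  have a13: "A$1$3 = 0" and a23: "A$2$3 = 0" and a33: "A$3$3 = 1"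
    using ax by (simp_all add: vec_eq_iff forall_3 matrix_vector_mult_def sum_3 axis_def)
  have a31: "A$3$1 = 0" and a32: "A$3$2 = 0"
    using row by (simp_all add: vec_eq_iff forall_3 matrix_vector_mult_def sum_3 axis_def
        transpose_def)
  have d: "A$1$1 * A$2$2 - A$1$2 * A$2$1 = 1"
    using det by (simp add: det_3 a13 a23 a33 a31 a32)
  have n: "(A$1$1)\<^sup>2 + (A$2$1)\<^sup>2 = 1" and o: "A$1$1 * A$1$2 + A$2$1 * A$2$2 = 0"
    using orth by (simp_all add: vec_eq_iff forall_3 matrix_matrix_mult_def sum_3 mat_def
        transpose_def a31 a32 power2_eq_square)
  have a22: "A$2$2 = A$1$1" and a12: "A$1$2 = - A$2$1"
    using d n o by algebra+
  obtain \<psi> where "A$1$1 = cos \<psi>" "A$2$1 = sin \<psi>"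
    using sincos_total_2pi[OF n] by metis
  then have "A = Q3 \<psi>"
    by (simp add: vec_eq_iff forall_3 Q3_def a13 a23 a33 a31 a32 a22 a12)
  then show ?thesis
    by (rule that)
qed

lemma spherical_coordinates:
  fixes v :: "real^3"
  assumes "norm v = 1"
  obtains \<phi> \<theta> where "\<theta> \<in> {0..pi}" "v = Q3 \<phi> *v (Q2 \<theta> *v axis 3 1)"
proof -
  have n: "(v$1)\<^sup>2 + (v$2)\<^sup>2 + (v$3)\<^sup>2 = 1"
    using assms by (simp add: norm_eq_1 inner_vec_def sum_3 power2_eq_square)
  define \<theta> where "\<theta> = arccos (v$3)"
  have "(v$3)\<^sup>2 \<le> 1"
    using n zero_le_power2[of "v$1"] zero_le_power2[of "v$2"] by linarith
  then have b: "\<bar>v$3\<bar> \<le> 1"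
    by (simp add: abs_square_le_1)
  then have \<theta>: "\<theta> \<in> {0..pi}" "cos \<theta> = v$3"
    by (auto simp: \<theta>_def abs_le_iff arccos_lbound arccos_ubound)
  have s: "(v$1)\<^sup>2 + (v$2)\<^sup>2 = (sin \<theta>)\<^sup>2"
    using n \<theta>(2) by (simp add: sin_squared_eq)
  obtain \<phi> where \<phi>: "v$1 = sin \<theta> * cos \<phi>" "v$2 = sin \<theta> * sin \<phi>"
  proof (cases "sin \<theta> = 0")
    case True
    with s have "v$1 = 0" "v$2 = 0"
      by (simp_all add: sum_power2_eq_zero_iff)
    with True that show ?thesis
      by simp
  next
    case False
    with s have "(v$1 / sin \<theta>)\<^sup>2 + (v$2 / sin \<theta>)\<^sup>2 = 1"
      by (simp add: power_divide flip: add_divide_distrib)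
    then obtain \<phi> where "v$1 / sin \<theta> = cos \<phi>" "v$2 / sin \<theta> = sin \<phi>"
      by (rule sincos_total_2pi)
    with False that show ?thesis
      by (simp add: field_simps)
  qed
  have "v = Q3 \<phi> *v (Q2 \<theta> *v axis 3 1)"
    using \<phi> \<theta>(2) by (simp add: vec_eq_iff forall_3 Q3_def Q2_def matrix_vector_mult_def sum_3
        axis_def mult.commute)
  with \<theta>(1) show ?thesis
    by (rule that)
qed

text \<open>
  Spherical coordinates of \<open>A e\<^sub>3\<close> give \<open>\<phi>\<close> and \<open>\<theta>\<close>; undoing
  these two rotations leaves a rotation that fixes \<open>e\<^sub>3\<close>.
\<close>

lemma rotation_matrix_euler_angles:
  fixes A :: "real^3^3"
  assumes A: "rotation_matrix A"
  obtains \<phi> \<theta> \<psi> where "\<theta> \<in> {0..pi}" "A = Q3 \<phi> ** Q2 \<theta> ** Q3 \<psi>"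
proof -
  have "norm (A *v axis 3 1) = 1"
    using A orthogonal_transformation_norm[of "(*v) A"]
    by (simp add: rotation_matrix_def orthogonal_transformation_matrix norm_axis_1)
  then obtain \<phi> \<theta> where \<theta>: "\<theta> \<in> {0..pi}"
    and v: "A *v axis 3 1 = Q3 \<phi> *v (Q2 \<theta> *v axis 3 1)"
    by (rule spherical_coordinates)
  define C where "C = Q3 \<phi> ** Q2 \<theta>"
  have C: "rotation_matrix C"
    unfolding C_def by (intro rotation_matrix_mul rotation_matrix_Q3 rotation_matrix_Q2)
  then have inv: "C ** transpose C = mat 1" "transpose C ** C = mat 1"
    by (auto simp: rotation_matrix_def orthogonal_matrix_def)
  have "A *v axis 3 1 = C *v axis 3 1"
    by (simp add: v C_def matrix_vector_mul_assoc)
  then have "(transpose C ** A) *v axis 3 1 = axis 3 1"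
    by (metis inv(2) matrix_vector_mul_assoc matrix_vector_mul_lid)
  moreover have "rotation_matrix (transpose C ** A)"
    using A C by (intro rotation_matrix_mul rotation_matrix_transpose)
  ultimately obtain \<psi> where "transpose C ** A = Q3 \<psi>"
    using rotation_matrix_fixing_axis by metis
  then have "A = C ** Q3 \<psi>"
    by (metis inv(1) matrix_mul_assoc matrix_mul_lid)
  with \<theta> show ?thesis
    unfolding C_def by (rule that)
qed

section \<open>The common circles on the hemispheres\<close>

text \<open>
  For \<open>0 < \<theta> < \<pi>\<close> the sphere with centre \<open>- k0 e\<^sub>3\<close> and radius
  \<open>k0\<close> meets its image under \<open>Q2 \<theta>\<close> in a circle through the origin,
  symmetric about the plane spanned by the two centres; this is its parametrisation, starting at the
  origin.
\<close>

definition common_circle :: "real \<Rightarrow> real \<Rightarrow> real \<Rightarrow> real^3" where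
  "common_circle k0 \<theta> \<beta> = vector
     [k0/2 * sin \<theta> * (cos \<beta> - 1),
      k0 * cos (\<theta>/2) * sin \<beta>,
      k0 * (cos (\<theta>/2))\<^sup>2 * (cos \<beta> - 1)]"

lemma sin_eq_half: "sin \<theta> = 2 * sin (\<theta>/2) * cos (\<theta>/2)" for \<theta> :: real
  using sin_double[of "\<theta>/2"] by simp

lemma cos_eq_half: "cos \<theta> = (cos (\<theta>/2))\<^sup>2 - (sin (\<theta>/2))\<^sup>2" for \<theta> :: real
  using cos_double[of "\<theta>/2"] by simp

lemma cos_pi_minus_half: "cos ((pi - \<theta>)/2) = sin (\<theta>/2)"
  by (simp add: sin_cos_eq diff_divide_distrib)

lemma norm_frame:
  "(norm (a *\<^sub>R vector [x, y] + b *\<^sub>R vector [- y, x] :: real^2))\<^sup>2 = (a\<^sup>2 + b\<^sup>2) * (x\<^sup>2 + y\<^sup>2)"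
  unfolding power2_norm_eq_inner
  by (simp add: inner_vec_def sum_2 power2_eq_square algebra_simps)

text \<open>
  The expression under the square root of \<open>kappa\<close> is a perfect square. The condition
  \<open>cos \<beta> \<ge> 0\<close> ensures that its root has the sign for which the lifted point lies on
  the circle.
\<close>

lemma hvec_gamma:
  assumes k0: "k0 \<ge> 0" and \<beta>: "cos \<beta> \<ge> 0"
  shows "hvec k0 (gamma k0 \<phi> \<theta> \<beta>) = Q3 \<phi> *v common_circle k0 \<theta> \<beta>"
proof -
  define c s u where "c = cos (\<theta>/2)" and "s = sin (\<theta>/2)" and "u = cos \<beta>"
  have cs: "c\<^sup>2 + s\<^sup>2 = 1"
    by (simp add: c_def s_def)
  have u: "0 \<le> u" "u \<le> 1" "(sin \<beta>)\<^sup>2 = 1 - u\<^sup>2"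
    using \<beta> by (simp_all add: u_def sin_squared_eq)
  have "(norm (gamma k0 \<phi> \<theta> \<beta>))\<^sup>2 =
      ((k0/2 * sin \<theta> * (cos \<beta> - 1))\<^sup>2 + (k0 * cos (\<theta>/2) * sin \<beta>)\<^sup>2) * ((cos \<phi>)\<^sup>2 + (sin \<phi>)\<^sup>2)"
    unfolding gamma_def by (rule norm_frame)
  also have "\<dots> = (k0 * s * c * (u - 1))\<^sup>2 + (k0 * c)\<^sup>2 * (1 - u\<^sup>2)"
    by (simp add: sin_eq_half[of \<theta>] power_mult_distrib u(3) flip: c_def s_def u_def)
  finally have "k0\<^sup>2 - (norm (gamma k0 \<phi> \<theta> \<beta>))\<^sup>2 = (k0 * (1 - c\<^sup>2 * (1 - u)))\<^sup>2"
    using cs by algebra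
  moreover have "c\<^sup>2 * (1 - u) \<le> 1"
    using cs u by (intro mult_le_one) (auto, metis zero_le_power2 le_add_same_cancel1)
  ultimately have "kappa k0 (gamma k0 \<phi> \<theta> \<beta>) = k0 * (1 - c\<^sup>2 * (1 - u))"
    using k0 by (simp add: kappa_def)
  then show ?thesis
    by (simp add: vec_eq_iff forall_3 hvec_def gamma_def common_circle_def Q3_def
        matrix_vector_mult_def sum_3 c_def u_def algebra_simps)
qed

text \<open>
  The antipode of the sphere rotated by \<open>Q2 \<theta>\<close> is the sphere rotated by
  \<open>Q2 (\<theta> - pi)\<close>, and \<open>Q2 (\<theta> - pi)\<close> is \<open>Q2 (pi - \<theta>)\<close>
  conjugated by the half turn \<open>Q3 pi\<close>. Dual curves are therefore ordinary curves for the
  supplementary angle, turned by \<open>pi\<close>.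
\<close>

lemma gamma_dual_eq_gamma: "gamma_dual k0 \<phi> \<theta> \<beta> = gamma k0 (\<phi> + pi) (pi - \<theta>) \<beta>"
  by (simp add: vec_eq_iff forall_2 gamma_def gamma_dual_def cos_pi_minus_half)

text \<open>
  In the frame of the rotated sphere, the other sphere is rotated by \<open>- \<theta>\<close>, and
  \<open>Q2 (- \<theta>)\<close> is \<open>Q2 \<theta>\<close> conjugated by the half turn \<open>Q3 pi\<close>. So
  in that frame the common circle is the half turn of itself; the half turn also reverses the
  direction in which it is traversed.
\<close>

lemma Q2_common_circle:
  "Q2 \<theta> *v (Q3 pi *v common_circle k0 \<theta> (- \<beta>)) = common_circle k0 \<theta> \<beta>"
proof -
  obtain c s where cs: "cos (\<theta>/2) = c" "sin (\<theta>/2) = s" "c\<^sup>2 + s\<^sup>2 = 1"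
    using sin_cos_squared_add2 by blast
  show ?thesis
    using cs(3) unfolding vec_eq_iff forall_3
    by (simp add: cs(1,2) common_circle_def Q2_def Q3_def matrix_vector_mult_def sum_3
        sin_eq_half[of \<theta>] cos_eq_half[of \<theta>]) (intro conjI; algebra)
qed

text \<open>
  The analogous change of frame between the sphere and the antipode of its image. Taking the
  antipode restores the direction of traversal, so \<open>\<beta>\<close> keeps its sign.
\<close>

lemma Q2_common_circle_dual:
  "Q2 \<theta> *v common_circle k0 (pi - \<theta>) \<beta> = - (Q3 pi *v common_circle k0 (pi - \<theta>) \<beta>)"
proof -
  obtain c s where cs: "cos (\<theta>/2) = c" "sin (\<theta>/2) = s" "c\<^sup>2 + s\<^sup>2 = 1"
    using sin_cos_squared_add2 by blast
  show ?thesis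
    using cs(3) unfolding vec_eq_iff forall_3
    by (simp add: cs(1,2) common_circle_def Q2_def Q3_def matrix_vector_mult_def sum_3 cos_pi_minus_half
        sin_eq_half[of \<theta>] cos_eq_half[of \<theta>]) (intro conjI; algebra)
qed

section \<open>Matching of the data along the common circles\<close>

lemma cmod_fourier_minus: "cmod (fourier f (- y)) = cmod (fourier f y)"
proof -
  have "fourier f (- y) = cnj (fourier f y)"
    by (simp add: fourier_def exp_cnj flip: Bochner_Integration.integral_cnj)
  then show ?thesis
    by simp
qed

text \<open>
  The factor \<open>Q3 \<phi>\<close> turns the common circle into the position it has on the first
  hemisphere. On the second one \<open>Q3 (pi - \<psi>)\<close> cancels \<open>Q3 \<psi>\<close> up to the half
  turn that \<open>Q2_common_circle\<close> needs; for the dual curves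
  \<open>gamma_dual_eq_gamma\<close> contributes a second half turn, and the two cancel.
\<close>

lemma euler_angles_match:
  assumes k0: "k0 \<ge> 0" and R: "R t = R s ** (Q3 \<phi> ** Q2 \<theta> ** Q3 \<psi>)"
  shows "matching_angles k0 f R s t \<phi> \<psi> \<theta>"
  unfolding matching_angles_def
proof (intro conjI ballI)
  fix \<beta> :: real
  assume "\<beta> \<in> {-pi/2..pi/2}"
  then have \<beta>: "cos \<beta> \<ge> 0" "cos (- \<beta>) \<ge> 0"
    by (simp_all add: cos_ge_zero)
  note circle = hvec_gamma[OF k0 \<beta>(1)] hvec_gamma[OF k0 \<beta>(2)]
  have "R t *v hvec k0 (gamma k0 (pi - \<psi>) \<theta> (- \<beta>)) =
      R s *v (Q3 \<phi> *v (Q2 \<theta> *v ((Q3 \<psi> ** Q3 (pi - \<psi>)) *v common_circle k0 \<theta> (- \<beta>))))"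
    unfolding circle R by (simp add: matrix_vector_mul_assoc matrix_mul_assoc)
  also have "\<dots> = R s *v hvec k0 (gamma k0 \<phi> \<theta> \<beta>)"
    by (simp add: Q3_Q3 Q2_common_circle circle)
  finally show "nu k0 f R s (gamma k0 \<phi> \<theta> \<beta>) = nu k0 f R t (gamma k0 (pi - \<psi>) \<theta> (- \<beta>))"
    by (simp add: nu_def)
  have "R t *v hvec k0 (gamma_dual k0 (pi - \<psi>) \<theta> \<beta>) =
      R s *v (Q3 \<phi> *v (Q2 \<theta> *v
        ((Q3 \<psi> ** Q3 (pi - \<psi> + pi)) *v common_circle k0 (pi - \<theta>) \<beta>)))"
    unfolding gamma_dual_eq_gamma circle R by (simp add: matrix_vector_mul_assoc matrix_mul_assoc)
  also have "Q3 \<psi> ** Q3 (pi - \<psi> + pi) = mat 1"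
    by (simp add: Q3_Q3)
  also have "R s *v (Q3 \<phi> *v (Q2 \<theta> *v (mat 1 *v common_circle k0 (pi - \<theta>) \<beta>))) =
      - (R s *v hvec k0 (gamma_dual k0 \<phi> \<theta> \<beta>))"
    by (simp add: Q2_common_circle_dual gamma_dual_eq_gamma circle linear_neg[OF matrix_vector_mul_linear]
        matrix_vector_mul_assoc flip: Q3_Q3)
  finally show "nu k0 f R s (gamma_dual k0 \<phi> \<theta> \<beta>) = nu k0 f R t (gamma_dual k0 (pi - \<psi>) \<theta> \<beta>)"
    by (simp add: nu_def cmod_fourier_minus)
qed

theorem theorem3p6:
  fixes k0 T :: real
    and f :: "real^3 \<Rightarrow> real"
    and R :: "real \<Rightarrow> real^3^3"
    and s t \<phi> \<psi> \<theta> :: real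
  assumes k0: "k0 > 0" and T: "T > 0"
    and f_nonneg: "\<And>x. f x \<ge> 0"
    and f_pc: "piecewise_continuous f"
    and f_supp: "\<exists>r>0. closure {x. f x \<noteq> 0} \<subseteq> ball 0 r"
    and R_rot: "\<And>u. u \<in> {0..T} \<Longrightarrow> rotation_matrix (R u)"
    and R_0: "R 0 = mat 1"
    and s: "s \<in> {0..T}" and t: "t \<in> {0..T}"
    and no_rotation:
      "\<not> (\<exists>\<alpha>. \<forall>k\<in>ball 0 k0. nu k0 f R s (Q \<alpha> *v k) = nu k0 f R t k)"
    and no_reflection:
      "\<not> (\<exists>\<alpha>. \<forall>k\<in>ball 0 k0. nu k0 f R s ((S ** Q \<alpha>) *v k) = nu k0 f R t k)"
    and \<theta>: "\<theta> \<in> {0..pi}"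
    and matching: "matching_angles k0 f R s t \<phi> \<psi> \<theta>"
    and unique: "\<And>\<phi>' \<psi>' \<theta>'. \<theta>' \<in> {0..pi} \<Longrightarrow> matching_angles k0 f R s t \<phi>' \<psi>' \<theta>' \<Longrightarrow>
      [\<phi>' = \<phi>] (rmod (2 * pi)) \<and> [\<psi>' = \<psi>] (rmod (2 * pi)) \<and> \<theta>' = \<theta>"
  shows "transpose (R s) ** R t = Q3 \<phi> ** Q2 \<theta> ** Q3 \<psi>"
proof -
  have Rs: "rotation_matrix (R s)" and Rt: "rotation_matrix (R t)"
    using R_rot s t by auto
  obtain \<phi>' \<theta>' \<psi>' where \<theta>': "\<theta>' \<in> {0..pi}"
    and E: "transpose (R s) ** R t = Q3 \<phi>' ** Q2 \<theta>' ** Q3 \<psi>'"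
    using rotation_matrix_euler_angles[OF rotation_matrix_mul[OF rotation_matrix_transpose[OF Rs] Rt]]
    by metis
  have "R s ** transpose (R s) = mat 1"
    using Rs by (simp add: rotation_matrix_def orthogonal_matrix_def)
  then have "R t = R s ** (Q3 \<phi>' ** Q2 \<theta>' ** Q3 \<psi>')"
    by (metis E matrix_mul_assoc matrix_mul_lid)
  then have "matching_angles k0 f R s t \<phi>' \<psi>' \<theta>'"
    using k0 by (intro euler_angles_match) auto
  then have "[\<phi>' = \<phi>] (rmod (2 * pi))" "[\<psi>' = \<psi>] (rmod (2 * pi))" "\<theta>' = \<theta>"
    using unique[OF \<theta>'] by auto
  then show ?thesis
    using E Q3_rcong by metis
qed

end
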